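(* Let $G$ be a finite simple connected graph with $n$ vertices and $m$ edges. Then $$F(G^{+++})=8F(G)+\xi_4(G)+3\,\mathrm{ReZG}_3(G).$$
   Context: For a finite simple graph $H$ with vertex set $V(H)$ and edge set $E(H)$, $d_H(v)$ denotes the degree of the vertex $v$ in $H$. The F-index of $H$ is $F(H)=\sum_{v\in V(H)} d_H(v)^3$. Further, $\xi_4(H)=\sum_{v\in V(H)} d_H(v)^4=\sum_{uv\in E(H)}[d_H(u)^3+d_H(v)^3]$ and $\mathrm{ReZG}_3(H)=\sum_{uv\in E(H)} d_H(u)d_H(v)[d_H(u)+d_H(v)]$. For $x,y,z\in\{+,-\}$, the total transformation graph $G^{xyz}$ is the simple graph with vertex set $V(G)\cup E(G)$ (disjoint union) in which two distinct elements $u,v$ are adjacent if and only if one of the following holds: (i) $u,v\in V(G)$, and $u,v$ are adjacent in $G$ if $x=+$, respectively not adjacent in $G$ if $x=-$; (ii) $u,v\in E(G)$, and $u,v$ are adjacent in $G$ (share an endpoint) if $y=+$, respectively not adjacent in $G$ if $y=-$; (iii) one of them is a vertex of $G$ and the other is an edge of $G$, and they are incident in $G$ if $z=+$, respectively not incident in $G$ if $z=-$. *)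

theory Defs
  imports Main
begin

record 'a ugraph =
  verts :: "'a set"
  edges :: "'a set set"

definition finite_simple_graph :: "'a ugraph \<Rightarrow> bool" where
  "finite_simple_graph G \<longleftrightarrow>
     finite (verts G) \<and> (\<forall>e \<in> edges G. e \<subseteq> verts G \<and> card e = 2)"

definition adjacent :: "'a ugraph \<Rightarrow> 'a \<Rightarrow> 'a \<Rightarrow> bool" where
  "adjacent G u v \<longleftrightarrow> {u, v} \<in> edges G"

text \<open>The graph without vertices does not count as connected.\<close>

definition connected_graph :: "'a ugraph \<Rightarrow> bool" where
  "connected_graph G \<longleftrightarrow>
     verts G \<noteq> {} \<and> (\<forall>u \<in> verts G. \<forall>v \<in> verts G. (adjacent G)\<^sup>*\<^sup>* u v)"

definition vdegree :: "'a ugraph \<Rightarrow> 'a \<Rightarrow> nat" where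
  "vdegree G v = card {e \<in> edges G. v \<in> e}"

definition F_index :: "'a ugraph \<Rightarrow> nat" where
  "F_index G = (\<Sum>v \<in> verts G. vdegree G v ^ 3)"

definition xi4 :: "'a ugraph \<Rightarrow> nat" where
  "xi4 G = (\<Sum>v \<in> verts G. vdegree G v ^ 4)"

text \<open>
  The summand is written as a symmetric function of the edge as a set, so that no
  choice of an ordering of its endpoints is needed; for an edge \<open>uv\<close> it is
  \<open>d(u) d(v) (d(u) + d(v))\<close>, see \<open>ReZG3_summand\<close> below.
\<close>

definition ReZG3 :: "'a ugraph \<Rightarrow> nat" where
  "ReZG3 G = (\<Sum>e \<in> edges G. (\<Prod>v \<in> e. vdegree G v) * (\<Sum>v \<in> e. vdegree G v))"

lemma ReZG3_summand:
  assumes "u \<noteq> v"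
  shows "(\<Prod>w \<in> {u, v}. vdegree G w) * (\<Sum>w \<in> {u, v}. vdegree G w)
       = vdegree G u * vdegree G v * (vdegree G u + vdegree G v)"
  using assms by simp

datatype sign = Plus | Minus

fun signed :: "sign \<Rightarrow> bool \<Rightarrow> bool" where
  "signed Plus P = P"
| "signed Minus P = (\<not> P)"

text \<open>
  Adjacency in the transformation graph. It is only meaningful for two distinct elements
  of \<open>verts G <+> edges G\<close>; both restrictions are imposed in \<open>transformation_graph\<close>.
\<close>

fun trans_adjacent ::
  "sign \<Rightarrow> sign \<Rightarrow> sign \<Rightarrow> 'a ugraph \<Rightarrow> 'a + 'a set \<Rightarrow> 'a + 'a set \<Rightarrow> bool" where
  "trans_adjacent x y z G (Inl u) (Inl v) = signed x (adjacent G u v)"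
| "trans_adjacent x y z G (Inr e) (Inr f) = signed y (e \<inter> f \<noteq> {})"
| "trans_adjacent x y z G (Inl u) (Inr e) = signed z (u \<in> e)"
| "trans_adjacent x y z G (Inr e) (Inl u) = signed z (u \<in> e)"

definition transformation_graph ::
  "sign \<Rightarrow> sign \<Rightarrow> sign \<Rightarrow> 'a ugraph \<Rightarrow> ('a + 'a set) ugraph" where
  "transformation_graph x y z G =
     \<lparr> verts = verts G <+> edges G,
       edges = {{p, q} | p q. p \<in> verts G <+> edges G \<and> q \<in> verts G <+> edges G \<and>
                              p \<noteq> q \<and> trans_adjacent x y z G p q} \<rparr>"

lemma finite_simple_graph_transformation_graph:
  assumes "finite_simple_graph G"
  shows "finite_simple_graph (transformation_graph x y z G)"
proof -
  have "edges G \<subseteq> Pow (verts G)" "finite (verts G)"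
    using assms by (auto simp: finite_simple_graph_def)
  then have "finite (edges G)"
    by (meson finite_Pow_iff finite_subset)
  with \<open>finite (verts G)\<close> show ?thesis
    by (auto simp: finite_simple_graph_def transformation_graph_def card_2_iff)
qed

end

theory Submission
  imports Defs
begin

text \<open>
  In \<open>G\<^sup>+\<^sup>+\<^sup>+\<close> a vertex \<open>v\<close> of \<open>G\<close> has degree \<open>2 d(v)\<close>, and an edge \<open>e = uv\<close> has degree
  \<open>d(u) + d(v)\<close>: two endpoints and \<open>d(u) + d(v) - 2\<close> adjacent edges. Expanding the cubes,
  the vertices contribute \<open>8 F(G)\<close> and the edges \<open>(d(u)\<^sup>3 + d(v)\<^sup>3) + 3 d(u) d(v) (d(u) + d(v))\<close>.
\<close>

lemma finite_edges: "finite_simple_graph G \<Longrightarrow> finite (edges G)"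
  by (rule finite_subset[of _ "Pow (verts G)"]) (auto simp: finite_simple_graph_def)

text \<open>Every edge at \<open>v\<close> has exactly one other endpoint, so \<open>u\<close> and
  \<open>{v, u}\<close> determine each other. This lets degrees in the transformation graph be read
  off from \<open>trans_adjacent\<close>.\<close>

lemma vdegree_eq_card_neighbours:
  assumes "finite_simple_graph G"
  shows "vdegree G v = card {u. adjacent G v u}"
proof -
  have "bij_betw (\<lambda>u. {v, u}) {u. adjacent G v u} {e \<in> edges G. v \<in> e}"
  proof (rule bij_betw_imageI)
    show "inj_on (\<lambda>u. {v, u}) {u. adjacent G v u}"
      by (auto simp: inj_on_def doubleton_eq_iff)
    have "\<exists>u. e = {v, u}" if "e \<in> edges G" "v \<in> e" for e
      using assms that by (auto simp: finite_simple_graph_def card_2_iff)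
    then show "(\<lambda>u. {v, u}) ` {u. adjacent G v u} = {e \<in> edges G. v \<in> e}"
      by (fastforce simp: adjacent_def)
  qed
  then show ?thesis
    by (simp add: vdegree_def bij_betw_same_card)
qed

text \<open>An edge \<open>{p, q}\<close> does not record the order of its ends, so symmetry is
  needed to recover adjacency from the set comprehension defining the edges.\<close>

lemma trans_adjacent_commute: "trans_adjacent x y z G p q \<longleftrightarrow> trans_adjacent x y z G q p"
  by (cases p; cases q; cases x; cases y) (auto simp: adjacent_def insert_commute)

lemma adjacent_transformation_graph:
  "adjacent (transformation_graph x y z G) p q \<longleftrightarrow>
     p \<in> verts G <+> edges G \<and> q \<in> verts G <+> edges G \<and> p \<noteq> q \<and> trans_adjacent x y z G p q"
  unfolding adjacent_def transformation_graph_def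
  using trans_adjacent_commute[of x y z G p q] by (simp add: doubleton_eq_iff) blast

lemma vdegree_total_graph_Inl:
  assumes G: "finite_simple_graph G" and v: "v \<in> verts G"
  shows "vdegree (transformation_graph Plus Plus Plus G) (Inl v) = 2 * vdegree G v"
proof -
  \<comment> \<open>Since \<open>G\<close> has no loops, the condition \<open>p \<noteq> q\<close>
    in the transformation graph removes no neighbour of \<open>v\<close>.\<close>
  have nb: "u \<in> verts G \<and> u \<noteq> v" if "adjacent G v u" for u
    using G that by (force simp: finite_simple_graph_def adjacent_def)
  have "{q. adjacent (transformation_graph Plus Plus Plus G) (Inl v) q} =
        {u. adjacent G v u} <+> {e \<in> edges G. v \<in> e}" (is "?L = ?R")
  proof (rule set_eqI)
    show "q \<in> ?L \<longleftrightarrow> q \<in> ?R" for q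
      using v nb by (cases q) (auto simp: adjacent_transformation_graph)
  qed
  moreover have "finite {u. adjacent G v u}"
    using nb G by (auto simp: finite_simple_graph_def intro: finite_subset[of _ "verts G"])
  ultimately show ?thesis
    using finite_edges[OF G]
    by (simp add: vdegree_eq_card_neighbours[OF finite_simple_graph_transformation_graph[OF G]]
        card_Plus vdegree_eq_card_neighbours[OF G, symmetric] vdegree_def[symmetric])
qed

lemma vdegree_total_graph_Inr:
  assumes G: "finite_simple_graph G" and e: "e \<in> edges G"
  shows "vdegree (transformation_graph Plus Plus Plus G) (Inr e) = (\<Sum>v \<in> e. vdegree G v)"
proof -
  obtain a b where ab: "e = {a, b}" "a \<noteq> b"
    using G e by (auto simp: finite_simple_graph_def card_2_iff)
  have eV: "e \<subseteq> verts G"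
    using G e by (auto simp: finite_simple_graph_def)
  let ?A = "{f \<in> edges G. a \<in> f}" and ?B = "{f \<in> edges G. b \<in> f}"
  have fin: "finite ?A" "finite ?B"
    using finite_edges[OF G] by auto
  \<comment> \<open>Two distinct vertices share at most one edge, so \<open>e\<close> alone is
    counted twice in the degree sum.\<close>
  have "f = e" if "f \<in> edges G" "a \<in> f" "b \<in> f" for f
    using G that ab by (auto simp: finite_simple_graph_def card_2_iff)
  then have "?A \<inter> ?B = {e}"
    using e ab(1) by blast
  then have "vdegree G a + vdegree G b = card (?A \<union> ?B) + 1"
    using card_Un_Int[OF fin] by (simp add: vdegree_def)
  also have "card (?A \<union> ?B) = card (?A \<union> ?B - {e}) + 1"
    using card.remove[of "?A \<union> ?B" e] fin e ab by simp
  \<comment> \<open>One unit comes from counting \<open>e\<close> twice, the other from removing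
    \<open>e\<close>, which is not its own neighbour; together they equal \<open>card e\<close>, the
    number of endpoints adjacent to \<open>e\<close>.\<close>
  finally have sum: "vdegree G a + vdegree G b = card e + card (?A \<union> ?B - {e})"
    using ab by simp
  have "{q. adjacent (transformation_graph Plus Plus Plus G) (Inr e) q} =
        e <+> (?A \<union> ?B - {e})" (is "?L = ?R")
  proof (rule set_eqI)
    show "q \<in> ?L \<longleftrightarrow> q \<in> ?R" for q
      using e eV ab by (cases q) (auto simp: adjacent_transformation_graph)
  qed
  then have "vdegree (transformation_graph Plus Plus Plus G) (Inr e) =
      card (e <+> (?A \<union> ?B - {e}))"
    by (simp add: vdegree_eq_card_neighbours[OF finite_simple_graph_transformation_graph[OF G]])
  also have "\<dots> = card e + card (?A \<union> ?B - {e})"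
    using fin ab by (intro card_Plus) auto
  finally show ?thesis
    using sum ab by simp
qed

text \<open>Double counting of incident pairs: \<open>f v\<close> occurs once for each edge through
  \<open>v\<close>.\<close>

lemma sum_edges_sum_endpoints:
  fixes f :: "'a \<Rightarrow> nat"
  assumes "finite_simple_graph G"
  shows "(\<Sum>e \<in> edges G. \<Sum>v \<in> e. f v) = (\<Sum>v \<in> verts G. vdegree G v * f v)"
proof -
  have V: "finite (verts G)" and sub: "\<And>e. e \<in> edges G \<Longrightarrow> {v \<in> verts G. v \<in> e} = e"
    using assms by (auto simp: finite_simple_graph_def)
  have "(\<Sum>e \<in> edges G. \<Sum>v \<in> e. f v) = (\<Sum>e \<in> edges G. \<Sum>v | v \<in> verts G \<and> v \<in> e. f v)"
    using sub by simp
  also have "\<dots> = (\<Sum>v \<in> verts G. \<Sum>e | e \<in> edges G \<and> v \<in> e. f v)"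
    by (rule sum.swap_restrict[OF finite_edges[OF assms] V])
  finally show ?thesis
    by (simp add: vdegree_def)
qed

theorem theorem2:
  fixes G :: "'a ugraph" and n m :: nat
  assumes "finite_simple_graph G"
    and "connected_graph G"
    and "card (verts G) = n"
    and "card (edges G) = m"
  shows "F_index (transformation_graph Plus Plus Plus G) = 8 * F_index G + xi4 G + 3 * ReZG3 G"
proof -
  note G = assms(1)
  have V: "finite (verts G)"
    using G by (simp add: finite_simple_graph_def)
  let ?T = "transformation_graph Plus Plus Plus G" and ?d = "vdegree G"
  \<comment> \<open>This is \<open>(a + b)^3 = a^3 + b^3 + 3 * (a * b * (a + b))\<close>, phrased
    over \<open>e\<close> as a set to match the summand of \<open>ReZG3\<close>.\<close>
  have cube: "(\<Sum>v \<in> e. ?d v) ^ 3 =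
      (\<Sum>v \<in> e. ?d v ^ 3) + 3 * ((\<Prod>v \<in> e. ?d v) * (\<Sum>v \<in> e. ?d v))" if "e \<in> edges G" for e
  proof -
    obtain a b where "e = {a, b}" "a \<noteq> b"
      using G \<open>e \<in> edges G\<close> by (auto simp: finite_simple_graph_def card_2_iff)
    then show ?thesis
      by (simp add: power3_eq_cube algebra_simps)
  qed
  have "F_index ?T = (\<Sum>p \<in> verts G <+> edges G. vdegree ?T p ^ 3)"
    by (simp add: F_index_def transformation_graph_def)
  also have "\<dots> = (\<Sum>v \<in> verts G. vdegree ?T (Inl v) ^ 3) + (\<Sum>e \<in> edges G. vdegree ?T (Inr e) ^ 3)"
    by (simp add: sum.Plus[OF V finite_edges[OF G]] comp_def)
  also have "(\<Sum>v \<in> verts G. vdegree ?T (Inl v) ^ 3) = 8 * F_index G"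
    using G by (simp add: vdegree_total_graph_Inl F_index_def power_mult_distrib sum_distrib_left)
  also have "(\<Sum>e \<in> edges G. vdegree ?T (Inr e) ^ 3) =
      (\<Sum>e \<in> edges G. \<Sum>v \<in> e. ?d v ^ 3) + 3 * ReZG3 G"
    using G cube by (simp add: vdegree_total_graph_Inr ReZG3_def sum.distrib sum_distrib_left)
  \<comment> \<open>Double counting with \<open>f\<close> the cubed degree: the extra factor
    \<open>?d v\<close> gives the fourth power.\<close>
  also have "(\<Sum>e \<in> edges G. \<Sum>v \<in> e. ?d v ^ 3) = xi4 G"
    by (simp add: sum_edges_sum_endpoints[OF G] xi4_def flip: power_Suc)
  finally show ?thesis
    by simp
qed

end
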